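(* Let $\mathcal D$ be a full factorial design with $m$ factors and let $t$ be a strength, $0\le t\le m$. Identify each fraction of $\mathcal D$ with its counting function, viewed as a vector in $\mathbb N^{\#\mathcal D}$. Then the set $OA(\bullet,\mathcal D,t)$ of all Orthogonal Arrays of strength $t$ of $\mathcal D$ (of any size) can be written in the form $$OA(\bullet,\mathcal D,t)=C\cap\mathbb N^{\#\mathcal D},$$ where $C$ is a polyhedral cone in $\mathbb R^{\#\mathcal D}$.
   Context: Let $s_1,\dots,s_m$ be positive integers. For $j=1,\dots,m$ let $\mathcal D_j$ be the set of the $s_j$-th roots of unity in $\mathbb C$ (the levels of the $j$-th factor) and let $\mathcal D=\mathcal D_1\times\cdots\times\mathcal D_m$ be the full factorial design. A fraction $\mathcal F$ of $\mathcal D$ is a finite multiset of elements of $\mathcal D$; its counting function $R:\mathcal D\to\mathbb N=\{0,1,2,\dots\}$ gives the number of appearances $R(\zeta)$ of each $\zeta\in\mathcal D$ in $\mathcal F$. For $I=\{i_1<\cdots<i_k\}\subset\{1,\dots,m\}$ let $\pi_I(\zeta)=(\zeta_{i_1},\dots,\zeta_{i_k})$. The fraction $\mathcal F$ factorially projects onto the $I$-factors if the multiset $\pi_I(\mathcal F)$ (projection with multiplicities) has constant multiplicity function over $\mathcal D_{i_1}\times\cdots\times\mathcal D_{i_k}$. A fraction is an Orthogonal Array of strength $t$ if it factorially projects onto the $I$-factors for every $I\subset\{1,\dots,m\}$ with $\#I=t$. The empty fraction (counting function identically $0$) is counted as an Orthogonal Array. A subset $C\subset\mathbb R^k$ is a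 cone if $\lambda x+\mu y\in C$ for all $x,y\in C$ and all real $\lambda,\mu\ge0$; it is a polyhedral cone if in addition it can be written as $C=\{x\in\mathbb R^k: Ax\ge0\}$ (componentwise inequality) for some real matrix $A$ with finitely many rows. *)

theory Defs
  imports Complex_Main "HOL-Library.Multiset" "HOL-Library.FuncSet" "Jordan_Normal_Form.Matrix"
begin

definition levels :: "nat \<Rightarrow> complex set" where
  "levels n = {z. z ^ n = 1}"

text \<open>Factors are numbered by \<open>1, \<dots>, m\<close>. Points of a design on the factors \<open>I\<close> are
  extensional functions on \<open>I\<close>, so that restriction to \<open>I\<close> is the coordinate projection.\<close>

definition design_on :: "(nat \<Rightarrow> nat) \<Rightarrow> nat set \<Rightarrow> (nat \<Rightarrow> complex) set" where
  "design_on s I = (\<Pi>\<^sub>E j\<in>I. levels (s j))"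

definition full_design :: "nat \<Rightarrow> (nat \<Rightarrow> nat) \<Rightarrow> (nat \<Rightarrow> complex) set" where
  "full_design m s = design_on s {1..m}"

definition fraction :: "nat \<Rightarrow> (nat \<Rightarrow> nat) \<Rightarrow> (nat \<Rightarrow> complex) multiset \<Rightarrow> bool" where
  "fraction m s F \<longleftrightarrow> set_mset F \<subseteq> full_design m s"

definition proj :: "nat set \<Rightarrow> (nat \<Rightarrow> complex) \<Rightarrow> (nat \<Rightarrow> complex)" where
  "proj I \<zeta> = restrict \<zeta> I"

definition factorially_projects ::
    "(nat \<Rightarrow> nat) \<Rightarrow> nat set \<Rightarrow> (nat \<Rightarrow> complex) multiset \<Rightarrow> bool" where
  "factorially_projects s I F \<longleftrightarrow>
     (\<exists>c. \<forall>\<eta>\<in>design_on s I. count (image_mset (proj I) F) \<eta> = c)"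

definition orthogonal_arrays ::
    "nat \<Rightarrow> (nat \<Rightarrow> nat) \<Rightarrow> nat \<Rightarrow> (nat \<Rightarrow> complex) multiset set" where
  "orthogonal_arrays m s t =
     {F. fraction m s F \<and>
         (\<forall>I. I \<subseteq> {1..m} \<and> card I = t \<longrightarrow> factorially_projects s I F)}"

text \<open>The counting function as a vector, its \<open>k\<close> coordinates being ordered by an
  enumeration \<open>e\<close> of the design by \<open>{..<k}\<close>.\<close>

definition counting_vec :: "nat \<Rightarrow> (nat \<Rightarrow> 'a) \<Rightarrow> 'a multiset \<Rightarrow> real vec" where
  "counting_vec k e F = vec k (\<lambda>i. real (count F (e i)))"

definition nat_vecs :: "nat \<Rightarrow> real vec set" where
  "nat_vecs k = {x \<in> carrier_vec k. \<forall>i<k. x $ i \<in> \<nat>}"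

definition cone_vec :: "nat \<Rightarrow> real vec set \<Rightarrow> bool" where
  "cone_vec k C \<longleftrightarrow> C \<subseteq> carrier_vec k \<and>
     (\<forall>x\<in>C. \<forall>y\<in>C. \<forall>a\<ge>0. \<forall>b\<ge>0. a \<cdot>\<^sub>v x + b \<cdot>\<^sub>v y \<in> C)"

definition polyhedral_cone :: "nat \<Rightarrow> real vec set \<Rightarrow> bool" where
  "polyhedral_cone k C \<longleftrightarrow> cone_vec k C \<and>
     (\<exists>r. \<exists>A\<in>carrier_mat r k. C = {x \<in> carrier_vec k. 0\<^sub>v r \<le> A *\<^sub>v x})"

lemma finite_full_design:
  assumes "\<forall>j\<in>{1..m}. s j \<ge> 1"
  shows "finite (full_design m s)"
proof -
  have "finite (levels (s j))" if "j \<in> {1..m}" for j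
  proof -
    have "s j > 0" using assms that by force
    then show ?thesis unfolding levels_def by (rule finite_nth_roots)
  qed
  then show ?thesis
    unfolding full_design_def design_on_def by (intro finite_PiE) auto
qed

text \<open>Enumerations of the design exist, so the choice of one is no restriction.\<close>

lemma ex_enumeration_full_design:
  assumes "\<forall>j\<in>{1..m}. s j \<ge> 1"
  shows "\<exists>e. bij_betw e {..<card (full_design m s)} (full_design m s)"
  using ex_bij_betw_nat_finite[OF finite_full_design[OF assms]]
  by (simp add: atLeast0LessThan)

end

theory Submission
  imports Defs
begin

text \<open>
  Having a constant margin is a comparison of two margins at a time: a fraction projects
  factorially onto the factors \<open>I\<close> iff \<open>n\<^sub>\<eta> \<le> n\<^sub>\<eta>\<^sub>'\<close> for all ordered pairs \<open>(\<eta>, \<eta>')\<close> of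
  points of the design on \<open>I\<close>, where \<open>n\<^sub>\<eta>\<close> counts the runs lying over \<open>\<eta>\<close>. Unlike the
  equation ``all margins equal \<open>c\<close>'', these comparisons do not mention the unknown constant.
  Each margin is a sum of coordinates of the counting vector
  (\<open>count_image_mset_eq_margin\<close>), so each comparison is a homogeneous linear inequality with
  coefficients in \<open>{-1, 0, 1}\<close>. There are finitely many index sets \<open>I\<close> and finitely many points
  of the design on each, so these inequalities form the rows of a matrix and cut out a polyhedral cone
  (\<open>polyhedral_cone_if_finitely_many_inequalities\<close>).

  The cone lives in \<open>\<real>\<^sup>k\<close> and knows nothing of integrality. Multisets over the design
  correspond to the vectors with coordinates in \<open>\<nat>\<close> (\<open>counting_vec_in_nat_vecs\<close>,
  \<open>ex_mset_counting_vec\<close>), so intersecting the cone with these vectors gives exactly the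
  orthogonal arrays.
\<close>

text \<open>The inequalities may be indexed by any finite set; a numbering of that set turns the
  coefficient functions into the rows of the matrix.\<close>

lemma polyhedral_cone_if_finitely_many_inequalities:
  fixes g :: "'r \<Rightarrow> nat \<Rightarrow> real"
  assumes "finite P"
  shows "polyhedral_cone k {x \<in> carrier_vec k. \<forall>p\<in>P. 0 \<le> (\<Sum>i<k. g p i * x $ i)}"
    (is "polyhedral_cone k ?C")
proof -
  have "cone_vec k ?C"
    unfolding cone_vec_def
  proof (intro conjI ballI allI impI)
    fix x y and a b :: real
    assume x: "x \<in> ?C" and y: "y \<in> ?C" and ab: "0 \<le> a" "0 \<le> b"
    have "0 \<le> (\<Sum>i<k. g p i * (a \<cdot>\<^sub>v x + b \<cdot>\<^sub>v y) $ i)" if "p \<in> P" for p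
    proof -
      have "(\<Sum>i<k. g p i * (a \<cdot>\<^sub>v x + b \<cdot>\<^sub>v y) $ i)
          = (\<Sum>i<k. a * (g p i * x $ i) + b * (g p i * y $ i))"
        using x y by (intro sum.cong) (auto simp: algebra_simps)
      also have "\<dots> = a * (\<Sum>i<k. g p i * x $ i) + b * (\<Sum>i<k. g p i * y $ i)"
        by (simp add: sum.distrib sum_distrib_left)
      also have "\<dots> \<ge> 0" using x y ab that by simp
      finally show ?thesis .
    qed
    then show "a \<cdot>\<^sub>v x + b \<cdot>\<^sub>v y \<in> ?C" using x y by auto
  qed auto
  moreover obtain h where h: "bij_betw h {..<card P} P"
    using ex_bij_betw_nat_finite[OF assms] by (auto simp: atLeast0LessThan)
  define A where "A = mat (card P) k (\<lambda>(r, i). g (h r) i)"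
  have "?C = {x \<in> carrier_vec k. 0\<^sub>v (card P) \<le> A *\<^sub>v x}"
  proof (intro Collect_cong conj_cong refl)
    fix x :: "real vec" assume x: "x \<in> carrier_vec k"
    have "(A *\<^sub>v x) $ r = (\<Sum>i<k. g (h r) i * x $ i)" if "r < card P" for r
      using that x unfolding A_def
      by (auto simp: scalar_prod_def atLeast0LessThan intro!: sum.cong)
    then have "0\<^sub>v (card P) \<le> A *\<^sub>v x
        \<longleftrightarrow> (\<forall>r\<in>{..<card P}. 0 \<le> (\<Sum>i<k. g (h r) i * x $ i))"
      by (auto simp: less_eq_vec_def A_def)
    also have "\<dots> \<longleftrightarrow> (\<forall>p\<in>h ` {..<card P}. 0 \<le> (\<Sum>i<k. g p i * x $ i))"
      by simp
    finally show "(\<forall>p\<in>P. 0 \<le> (\<Sum>i<k. g p i * x $ i)) \<longleftrightarrow> 0\<^sub>v (card P) \<le> A *\<^sub>v x"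
      by (simp only: bij_betw_imp_surj_on[OF h])
  qed
  moreover have "A \<in> carrier_mat (card P) k" by (simp add: A_def)
  ultimately show ?thesis unfolding polyhedral_cone_def by blast
qed

lemma counting_vec_in_nat_vecs: "counting_vec k e F \<in> nat_vecs k"
  by (simp add: counting_vec_def nat_vecs_def)

lemma ex_mset_counting_vec:
  assumes "bij_betw e {..<k} D" and "x \<in> nat_vecs k"
  obtains F where "set_mset F \<subseteq> D" and "counting_vec k e F = x"
proof -
  have "\<forall>i<k. \<exists>n. x $ i = real n"
    using assms(2) by (auto simp: nat_vecs_def elim: Nats_cases)
  then obtain n where n: "x $ i = real (n i)" if "i < k" for i by metis
  define F where "F = (\<Sum>i<k. replicate_mset (n i) (e i))"
  have "set_mset F \<subseteq> D"
    using assms(1) by (auto simp: F_def set_mset_sum bij_betw_def split: if_splits)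
  moreover have "count F (e i) = n i" if "i < k" for i
  proof -
    have inj: "e i = e j \<longleftrightarrow> j = i" if "j < k" for j
      using assms(1) that \<open>i < k\<close> by (auto simp: bij_betw_def inj_on_def)
    have "count F (e i) = (\<Sum>j<k. if j = i then n j else 0)"
      unfolding F_def count_sum count_replicate_mset by (intro sum.cong refl) (simp add: inj)
    then show ?thesis using that by simp
  qed
  then have "counting_vec k e F = x"
    using assms(2) n by (auto simp: counting_vec_def nat_vecs_def)
  ultimately show thesis by (rule that)
qed

definition margin :: "nat \<Rightarrow> (nat \<Rightarrow> 'a) \<Rightarrow> ('a \<Rightarrow> 'b) \<Rightarrow> real vec \<Rightarrow> 'b \<Rightarrow> real" where
  "margin k e f x y = (\<Sum>i<k. of_bool (f (e i) = y) * x $ i)"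

lemma count_image_mset_eq_margin:
  assumes e: "bij_betw e {..<k} D" and F: "set_mset F \<subseteq> D"
  shows "real (count (image_mset f F) y) = margin k e f (counting_vec k e F) y"
proof -
  have "finite D" using e by (metis bij_betw_finite finite_lessThan)
  \<comment> \<open>Points of \<open>D\<close> outside \<open>F\<close> have count \<open>0\<close>, so the sum may run over all of \<open>D\<close>.\<close>
  have "count (image_mset f F) y = (\<Sum>d\<in>D. of_bool (f d = y) * count F d)"
    unfolding count_image_mset using F \<open>finite D\<close>
    by (intro sum.mono_neutral_cong_left) (auto simp: not_in_iff)
  also have "\<dots> = (\<Sum>i<k. of_bool (f (e i) = y) * count F (e i))"
    by (rule sum.reindex_bij_betw[OF e, symmetric])
  finally show ?thesis
    by (simp add: margin_def counting_vec_def)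
qed

lemma finite_design_on:
  assumes "finite I" and "\<forall>j\<in>I. s j \<ge> 1"
  shows "finite (design_on s I)"
  unfolding design_on_def levels_def
  using assms by (intro finite_PiE finite_nth_roots) force+

text \<open>Quantifying over ordered pairs eliminates the unknown constant and leaves only
  weak inequalities.\<close>

lemma constant_iff_pairwise_le:
  fixes h :: "'a \<Rightarrow> 'b :: order"
  shows "(\<exists>c. \<forall>y\<in>Y. h y = c) \<longleftrightarrow> (\<forall>y\<in>Y. \<forall>y'\<in>Y. h y \<le> h y')"
proof
  assume le: "\<forall>y\<in>Y. \<forall>y'\<in>Y. h y \<le> h y'"
  have "h y = h (SOME y'. y' \<in> Y)" if "y \<in> Y" for y
    using le that someI[of "\<lambda>y'. y' \<in> Y", OF that] by (simp add: order_antisym)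
  then show "\<exists>c. \<forall>y\<in>Y. h y = c" by blast
qed auto

lemma factorially_projects_iff_margin_le:
  assumes "bij_betw e {..<k} D" and "set_mset F \<subseteq> D"
  shows "factorially_projects s I F \<longleftrightarrow>
    (\<forall>\<eta>\<in>design_on s I. \<forall>\<eta>'\<in>design_on s I.
       margin k e (proj I) (counting_vec k e F) \<eta> \<le> margin k e (proj I) (counting_vec k e F) \<eta>')"
  unfolding factorially_projects_def constant_iff_pairwise_le
  by (simp only: count_image_mset_eq_margin[OF assms, symmetric] of_nat_le_iff)

theorem lemma1:
  fixes m t :: nat and s :: "nat \<Rightarrow> nat" and e :: "nat \<Rightarrow> (nat \<Rightarrow> complex)"
  assumes "\<forall>j\<in>{1..m}. s j \<ge> 1"
    and "t \<le> m"
    and "bij_betw e {..<card (full_design m s)} (full_design m s)"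
  shows "\<exists>C. polyhedral_cone (card (full_design m s)) C \<and>
    counting_vec (card (full_design m s)) e ` orthogonal_arrays m s t =
      C \<inter> nat_vecs (card (full_design m s))"
proof -
  define k where "k = card (full_design m s)"
  have e: "bij_betw e {..<k} (full_design m s)" using assms(3) by (simp add: k_def)
  define P where "P = (SIGMA I:{I. I \<subseteq> {1..m} \<and> card I = t}. design_on s I \<times> design_on s I)"
  define C where "C = {x \<in> carrier_vec k. \<forall>(I, \<eta>, \<eta>')\<in>P.
    margin k e (proj I) x \<eta> \<le> margin k e (proj I) x \<eta>'}"
  have "finite (design_on s I)" if "I \<subseteq> {1..m}" for I
    using that assms(1) by (intro finite_design_on finite_subset[OF that]) auto
  then have "finite P" unfolding P_def by (intro finite_SigmaI finite_cartesian_product) auto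
  define g :: "nat set \<times> (nat \<Rightarrow> complex) \<times> (nat \<Rightarrow> complex) \<Rightarrow> nat \<Rightarrow> real" where
    "g = (\<lambda>(I, \<eta>, \<eta>') i. of_bool (proj I (e i) = \<eta>') - of_bool (proj I (e i) = \<eta>))"
  have "(\<Sum>i<k. g (I, \<eta>, \<eta>') i * x $ i)
      = margin k e (proj I) x \<eta>' - margin k e (proj I) x \<eta>" for I \<eta> \<eta>' x
    by (simp add: g_def margin_def left_diff_distrib sum_subtractf)
  then have "C = {x \<in> carrier_vec k. \<forall>p\<in>P. 0 \<le> (\<Sum>i<k. g p i * x $ i)}"
    by (auto simp: C_def)
  then have "polyhedral_cone k C"
    using polyhedral_cone_if_finitely_many_inequalities[OF \<open>finite P\<close>] by simp
  moreover have OA_iff: "F \<in> orthogonal_arrays m s t \<longleftrightarrow> counting_vec k e F \<in> C"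
    if "set_mset F \<subseteq> full_design m s" for F
    using that factorially_projects_iff_margin_le[OF e that]
    by (auto simp: orthogonal_arrays_def fraction_def C_def P_def counting_vec_def)
  have "counting_vec k e ` orthogonal_arrays m s t = C \<inter> nat_vecs k"
  proof (intro equalityI subsetI)
    fix x assume "x \<in> counting_vec k e ` orthogonal_arrays m s t"
    then show "x \<in> C \<inter> nat_vecs k"
      using OA_iff counting_vec_in_nat_vecs
      by (auto simp: orthogonal_arrays_def fraction_def)
  next
    fix x assume x: "x \<in> C \<inter> nat_vecs k"
    then obtain F where "set_mset F \<subseteq> full_design m s" "counting_vec k e F = x"
      using ex_mset_counting_vec[OF e] by blast
    then show "x \<in> counting_vec k e ` orthogonal_arrays m s t"
      using x OA_iff by blast
  qed
  ultimately show ?thesis unfolding k_def by blast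
qed

end
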